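(* Let $t$ be a prime, $N$ a non-negative integer, $k$ an integer, and $\nu\in\{0,1,2,\ldots,t-1\}$. Let $$G_{tN+\nu,t}(k,q) := \sum_{\substack{\pi\in\mathcal{P}\\ \mathrm{GBG}^{(t)}(\pi)=k\\ l(\pi)\le tN+\nu}} q^{|\pi|}$$ be the generating function for partitions with all parts at most $tN+\nu$ and GBG-rank mod $t$ equal to $k$. Then $$G_{tN+\nu,t}(k,q) = \frac{q^{tk^2-(t-1)k}}{\displaystyle\prod_{i=0}^{t-1}(\tilde q;\tilde q)_{N+\lceil\frac{\nu-i}{t}\rceil-k\delta_{i,0}+k\delta_{i,t-1}}},\qquad \tilde q := q^t.$$
   Context: A partition is a non-increasing finite sequence $\pi=(\lambda_1,\lambda_2,\ldots)$ of positive integers (its parts); the empty partition is included. $|\pi|=\sum_i\lambda_i$ is its norm, and $l(\pi)$ is its largest part ($0$ for the empty partition). $\mathcal{P}$ is the set of all partitions. The Young diagram of $\pi$ has $\lambda_i$ cells in row $i$, left-justified; the cell in row $i$ and column $j$ ($i,j\ge1$) is labeled by the least non-negative integer congruent to $j-i$ modulo $t$. For $0\le s\le t-1$, $r_s(\pi,t)$ is the number of cells of $\pi$ labeled $s$. With $\omega_t=e^{2\pi\sqrt{-1}/t}$, the GBG-rank of $\pi$ mod $t$ is the complex number $$\mathrm{GBG}^{(t)}(\pi)=\sum_{s=0}^{t-1} r_s(\pi,t)\,\omega_t^s.$$ For $L\ge0$, $(a;q)_L=\prod_{m=0}^{L-1}(1-aq^m)$. The usual convention $1/(q;q)_L=0$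 for negative integers $L$ is in force, so the right-hand side is $0$ if one of the subscripts is negative. $\lceil x\rceil$ is the least integer $\ge x$, and $\delta_{i,j}$ is $1$ if $i=j$ and $0$ otherwise. The identity is one of formal power series in $q$ (or of analytic functions for $|q|<1$). *)

theory Defs
  imports Complex_Main "HOL-Computational_Algebra.Formal_Power_Series"
    "HOL-Computational_Algebra.Primes"
begin

text \<open>A partition is the list of its parts in non-increasing order.\<close>

definition partitions :: "nat list set" where
  "partitions = {xs. sorted_wrt (\<ge>) xs \<and> (\<forall>x\<in>set xs. 0 < x)}"

abbreviation norm_part :: "nat list \<Rightarrow> nat" where
  "norm_part \<equiv> sum_list"

text \<open>The inserted \<open>0\<close> only matters for the empty partition.\<close>

definition largest_part :: "nat list \<Rightarrow> nat" where
  "largest_part xs = Max (insert 0 (set xs))"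

text \<open>Cells are pairs (row, column), both counted from 1, whereas lists are indexed from 0.\<close>

definition young_diagram :: "nat list \<Rightarrow> (nat \<times> nat) set" where
  "young_diagram xs = {(i, j). 1 \<le> i \<and> i \<le> length xs \<and> 1 \<le> j \<and> j \<le> xs ! (i - 1)}"

definition cell_label :: "nat \<Rightarrow> nat \<times> nat \<Rightarrow> int" where
  "cell_label t c = (int (snd c) - int (fst c)) mod int t"

definition r_count :: "nat \<Rightarrow> nat list \<Rightarrow> nat \<Rightarrow> nat" where
  "r_count s xs t = card {c \<in> young_diagram xs. cell_label t c = int s}"

definition root_unity :: "nat \<Rightarrow> complex" where
  "root_unity t = exp (2 * of_real pi * \<i> / of_nat t)"

definition GBG_rank :: "nat \<Rightarrow> nat list \<Rightarrow> complex" where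
  "GBG_rank t xs = (\<Sum>s = 0..t - 1. of_nat (r_count s xs t) * root_unity t ^ s)"

text \<open>
  Power series in \<open>q\<close> are taken over the complex numbers, with \<open>q = fps_X\<close>. A sum of \<open>q ^ |\<pi>|\<close>
  over a set of partitions has as its \<open>n\<close>-th coefficient the number of partitions of norm \<open>n\<close> in
  that set; this number is finite by \<open>finite_partitions_norm\<close> below.
\<close>

definition part_gf :: "nat list set \<Rightarrow> complex fps" where
  "part_gf A = Abs_fps (\<lambda>n. of_nat (card {xs \<in> A. norm_part xs = n}))"

definition G :: "nat \<Rightarrow> nat \<Rightarrow> int \<Rightarrow> complex fps" where
  "G M t k = part_gf {xs \<in> partitions. GBG_rank t xs = of_int k \<and> largest_part xs \<le> M}"

definition qpoch :: "'a::comm_ring_1 \<Rightarrow> 'a \<Rightarrow> nat \<Rightarrow> 'a" where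
  "qpoch a q L = (\<Prod>m<L. 1 - a * q ^ m)"

text \<open>\<open>1 / (q;q)\<^sub>L\<close> for integer \<open>L\<close>, with the convention that it vanishes for negative \<open>L\<close>.\<close>

definition recip_qpoch :: "complex fps \<Rightarrow> int \<Rightarrow> complex fps" where
  "recip_qpoch q L = (if L < 0 then 0 else inverse (qpoch q q (nat L)))"

lemma finite_partitions_norm: "finite {xs \<in> partitions. norm_part xs = n}"
proof (rule finite_subset)
  have len: "length xs \<le> sum_list xs" if "\<forall>x\<in>set xs. 0 < x" for xs :: "nat list"
    using that by (induction xs) auto
  show "{xs \<in> partitions. norm_part xs = n} \<subseteq> {xs. set xs \<subseteq> {..n} \<and> length xs \<le> n}"
    using len by (auto simp: partitions_def intro: member_le_sum_list)
  show "finite {xs. set xs \<subseteq> {..n} \<and> length xs \<le> n}"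
    by (rule finite_lists_length_le) simp
qed

text \<open>
  The exponent \<open>t k\<^sup>2 - (t - 1) k\<close> is a non-negative integer, so converting it with \<open>nat\<close>
  loses nothing.
\<close>

lemma exponent_nonneg:
  assumes "1 \<le> t"
  shows "0 \<le> int t * k\<^sup>2 - (int t - 1) * k"
proof -
  have "k \<le> k\<^sup>2"
    by (cases "k \<le> 0") (auto simp: power2_eq_square intro: order_trans[of k 0])
  then have "(int t - 1) * k \<le> (int t - 1) * k\<^sup>2"
    using assms by (intro mult_left_mono) auto
  also have "\<dots> \<le> int t * k\<^sup>2"
    by (intro mult_right_mono) auto
  finally show ?thesis by simp
qed

end

theory Submission
  imports Defs "HOL-Computational_Algebra.Polynomial_Factorial"
begin

text \<open>
  Since \<open>t\<close> is prime, the only integer relation between the powers of \<open>\<omega>\<^sub>t\<close> is that they sum to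
  \<open>0\<close>; hence the GBG-rank is \<open>k\<close> iff the differences \<open>r\<^sub>s - r\<^bsub>s+1\<^esub>\<close> (indices mod \<open>t\<close>) are \<open>k\<close> for
  \<open>s = 0\<close>, \<open>-k\<close> for \<open>s = t - 1\<close> and \<open>0\<close> otherwise. Encode a partition with parts at most \<open>M = t N + \<nu>\<close>
  by the set of beta-numbers of its conjugate, an arbitrary \<open>M\<close>-element set of natural numbers whose
  sum is the norm plus \<open>M (M - 1) / 2\<close>. The difference \<open>r\<^sub>s - r\<^bsub>s+1\<^esub>\<close> only depends on the number of
  beta-numbers congruent to \<open>M - 1 - s\<close> mod \<open>t\<close>, so the rank condition prescribes how many
  beta-numbers lie in each residue class. The classes are then independent, and the generating
  function of the \<open>m\<close>-element sets of natural numbers is \<open>q ^ (m (m - 1) / 2) / (q; q)\<^sub>m\<close>.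
\<close>

subsection \<open>Linear independence of the powers of a root of unity of prime order\<close>

text \<open>Let \<open>i\<close> be the least index at which \<open>b\<close> has a coefficient
  prime to \<open>p\<close>. Modulo \<open>p\<close>, coefficient \<open>i\<close> of
  \<open>f\<close> is \<open>coeff a 0 * coeff b i\<close>, hence nonzero. So \<open>i\<close> is at
  least the degree of \<open>f\<close>, and \<open>a\<close> is a constant dividing the leading
  coefficient 1.\<close>

lemma eisenstein_unit_factor:
  fixes p :: int and f a b :: "int poly"
  assumes "prime p" and monic: "lead_coeff f = 1"
    and div: "\<And>i. i < degree f \<Longrightarrow> p dvd coeff f i"
    and f: "f = a * b" and a0: "\<not> p dvd coeff a 0"
  shows "a dvd 1"
proof -
  have nz: "a \<noteq> 0" "b \<noteq> 0"
    using monic f by auto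
  have lc: "lead_coeff a * lead_coeff b = 1"
    using monic f by (simp add: lead_coeff_mult)
  have lb: "\<not> p dvd lead_coeff b"
    using lc \<open>prime p\<close> by (metis dvd_mult dvd_trans not_prime_unit)
  define i where "i = (LEAST i. \<not> p dvd coeff b i)"
  have i: "\<not> p dvd coeff b i"
    unfolding i_def by (rule LeastI) (rule lb)
  have below: "p dvd coeff b j" if "j < i" for j
    using that not_less_Least unfolding i_def by blast
  have "i \<le> degree b"
    using i by (intro le_degree) auto
  have "coeff f i = (\<Sum>j\<le>i. coeff a j * coeff b (i - j))"
    by (simp add: f coeff_mult)
  also have "\<dots> = coeff a 0 * coeff b i + (\<Sum>j\<in>{..i} - {0}. coeff a j * coeff b (i - j))"
    by (subst sum.remove[of _ 0]) auto
  finally have eq: "coeff f i = coeff a 0 * coeff b i + (\<Sum>j\<in>{..i} - {0}. coeff a j * coeff b (i - j))" .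
  have "p dvd (\<Sum>j\<in>{..i} - {0}. coeff a j * coeff b (i - j))"
    by (intro dvd_sum dvd_mult below) auto
  moreover have "\<not> p dvd coeff a 0 * coeff b i"
    using a0 i \<open>prime p\<close> by (simp add: prime_dvd_mult_iff)
  ultimately have "\<not> p dvd coeff f i"
    unfolding eq by (simp add: dvd_add_left_iff)
  then have "degree f \<le> i"
    using div by (meson not_le_imp_less)
  then have "degree a = 0"
    using \<open>i \<le> degree b\<close> nz by (simp add: f degree_mult_eq)
  then obtain c where c: "a = [:c:]"
    by (rule degree_eq_zeroE)
  then have "c dvd 1"
    using lc by (metis coeff_pCons_0 degree_pCons_0 dvd_triv_left)
  then show ?thesis
    by (simp only: c is_unit_const_poly_iff)
qed

text \<open>If \<open>p\<close> divided both constant coefficients of a factorization, its square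
  would divide that of \<open>f\<close>. The factor whose constant coefficient escapes
  \<open>p\<close> is a unit.\<close>

lemma eisenstein_irreducible:
  fixes p :: int and f :: "int poly"
  assumes "prime p" and "lead_coeff f = 1" and "0 < degree f"
    and "\<And>i. i < degree f \<Longrightarrow> p dvd coeff f i" and "\<not> p\<^sup>2 dvd coeff f 0"
  shows "irreducible f"
proof (rule irreducibleI)
  show "f \<noteq> 0" "\<not> f dvd 1"
    using assms(3) by (auto simp: is_unit_poly_iff)
next
  fix a b assume f: "f = a * b"
  have "\<not> p dvd coeff a 0 \<or> \<not> p dvd coeff b 0"
    using assms(5) by (auto simp: f coeff_mult_0 power2_eq_square intro: mult_dvd_mono)
  then show "a dvd 1 \<or> b dvd 1"
    using eisenstein_unit_factor[OF assms(1,2,4), of a b] eisenstein_unit_factor[OF assms(1,2,4), of b a] f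
    by (auto simp: mult.commute)
qed

section \<open>Evaluation of integer polynomials\<close>

abbreviation ipoly :: "int poly \<Rightarrow> 'a::comm_ring_1 \<Rightarrow> 'a" where
  "ipoly f \<equiv> poly (map_poly of_int f)"

lemma ipoly_add: "ipoly (f + g) x = ipoly f x + ipoly g x"
proof -
  have "map_poly of_int (f + g) = (map_poly of_int f + map_poly of_int g :: 'a poly)"
    by (intro poly_eqI) (simp add: coeff_map_poly)
  then show ?thesis by simp
qed

lemma ipoly_smult: "ipoly (smult c f) x = of_int c * ipoly f x"
  by (simp add: map_poly_smult)

lemma ipoly_mult: "ipoly (f * g) x = ipoly f x * ipoly g x"
  by (induction f) (simp_all add: ipoly_add ipoly_smult map_poly_pCons algebra_simps)

lemma ipoly_pcompose: "ipoly (pcompose f g) x = ipoly f (ipoly g x)"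
  by (induction f) (simp_all add: pcompose_pCons ipoly_add ipoly_mult map_poly_pCons algebra_simps)

lemma ipoly_sum: "ipoly (\<Sum>i\<in>A. f i) x = (\<Sum>i\<in>A. ipoly (f i) x)"
  by (induction A rule: infinite_finite_induct) (simp_all add: ipoly_add)

text \<open>A nonzero \<open>g\<close> of least degree vanishing at \<open>x\<close> divides a
  multiple of \<open>f\<close> by a constant. As \<open>f\<close> is prime, it divides
  \<open>g\<close>, as wanted, or the quotient; the latter would make \<open>g\<close> a nonzero
  constant, which has no root.\<close>

lemma irreducible_min_degree:
  fixes f h :: "int poly" and x :: complex
  assumes irr: "irreducible f" and fx: "ipoly f x = 0"
    and "h \<noteq> 0" and "ipoly h x = 0"
  shows "degree f \<le> degree h"
proof -
  define P where "P n \<longleftrightarrow> (\<exists>g. g \<noteq> 0 \<and> ipoly g x = 0 \<and> degree g = n)" for n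
  have "P (degree h)"
    using assms unfolding P_def by blast
  then have "P (LEAST n. P n)" and least: "(LEAST n. P n) \<le> degree h"
    by (auto intro: LeastI Least_le)
  then obtain g where g: "g \<noteq> 0" "ipoly g x = 0" "degree g = (LEAST n. P n)"
    unfolding P_def by blast
  have "degree f \<le> degree g"
  proof -
    \<comment> \<open>Pseudo-division stays within the integers at the price of the nonzero factor
      \<open>a\<close>.\<close>
    obtain a q where a: "a \<noteq> 0" and eq: "smult a f = g * q + pseudo_mod f g"
      using pseudo_mod(1)[OF g(1)] by blast
    have "ipoly (smult a f) x = ipoly (g * q + pseudo_mod f g) x"
      by (simp only: eq)
    then have "ipoly (pseudo_mod f g) x = 0"
      by (simp add: ipoly_smult ipoly_add ipoly_mult fx g(2))
    then have "pseudo_mod f g = 0"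
      using pseudo_mod(2)[OF g(1), of f] g(3) not_less_Least[of "degree (pseudo_mod f g)" P]
      unfolding P_def by auto
    then have eq': "smult a f = g * q"
      using eq by simp
    have "prime_elem f"
      using irr by (rule irreducible_imp_prime_elem)
    moreover have "f dvd g * q"
      by (metis eq' dvd_refl dvd_smult)
    ultimately consider "f dvd g" | "f dvd q"
      using prime_elem_dvd_mult_iff by blast
    then show ?thesis
    proof cases
      case 1
      then show ?thesis
        using g(1) by (rule dvd_imp_degree_le)
    next
      case 2
      then obtain r where "q = f * r" ..
      with eq' have "f * [:a:] = f * (g * r)"
        by (simp add: mult_ac)
      moreover have "f \<noteq> 0"
        using irr by auto
      ultimately have "[:a:] = g * r"
        by (metis mult_cancel_left)
      then have "degree (g * r) = 0" "r \<noteq> 0"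
        using a by (metis degree_pCons_0, auto)
      then have "degree g = 0"
        using g(1) by (simp add: degree_mult_eq)
      then obtain c where "g = [:c:]"
        by (rule degree_eq_zeroE)
      with g show ?thesis
        by (simp add: map_poly_pCons)
    qed
  qed
  with g(3) least show ?thesis by simp
qed

text \<open>
  The cyclotomic polynomial \<open>((1 + X) ^ p - 1) / X\<close>, shifted so that Eisenstein's criterion applies.
\<close>

definition shifted_cyclotomic :: "nat \<Rightarrow> int poly" where
  "shifted_cyclotomic p = (\<Sum>i<p. monom (int (p choose Suc i)) i)"

lemma coeff_shifted_cyclotomic:
  "coeff (shifted_cyclotomic p) i = (if i < p then int (p choose Suc i) else 0)"
  by (simp add: shifted_cyclotomic_def coeff_sum)

lemma degree_shifted_cyclotomic:
  assumes "0 < p"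
  shows "degree (shifted_cyclotomic p) = p - 1"
proof (rule antisym)
  show "degree (shifted_cyclotomic p) \<le> p - 1"
    by (rule degree_le) (auto simp: coeff_shifted_cyclotomic)
  show "p - 1 \<le> degree (shifted_cyclotomic p)"
    by (rule le_degree) (use assms in \<open>auto simp: coeff_shifted_cyclotomic\<close>)
qed

text \<open>Eisenstein's criterion at \<open>p\<close>: the leading coefficient is 1, the constant
  one is \<open>p\<close>, and all but the leading one are binomial coefficients divisible by
  \<open>p\<close>.\<close>

lemma irreducible_shifted_cyclotomic:
  assumes "prime p"
  shows "irreducible (shifted_cyclotomic p)"
proof (rule eisenstein_irreducible)
  have p: "2 \<le> p"
    using assms by (rule prime_ge_2_nat)
  note deg = degree_shifted_cyclotomic[of p]
  show "prime (int p)"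
    using assms by simp
  show "lead_coeff (shifted_cyclotomic p) = 1" "0 < degree (shifted_cyclotomic p)"
    using p by (auto simp: deg coeff_shifted_cyclotomic)
  show "int p dvd coeff (shifted_cyclotomic p) i" if "i < degree (shifted_cyclotomic p)" for i
    using that p assms by (auto simp: deg coeff_shifted_cyclotomic intro!: dvd_choose_prime)
  show "\<not> (int p)\<^sup>2 dvd coeff (shifted_cyclotomic p) 0"
  proof
    assume "(int p)\<^sup>2 dvd coeff (shifted_cyclotomic p) 0"
    then have "int p * int p dvd int p"
      using p by (simp add: coeff_shifted_cyclotomic power2_eq_square)
    then have "p * p dvd p"
      by (metis of_nat_dvd_iff of_nat_mult)
    then have "p * p \<le> p"
      using p by (intro dvd_imp_le) auto
    then show False
      using p by simp
  qed
qed

lemma shifted_cyclotomic_mult: "ipoly (shifted_cyclotomic p) x * x = (1 + x) ^ p - 1"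
proof -
  have "(1 + x) ^ p = (\<Sum>i\<le>p. of_nat (p choose i) * x ^ i)"
    by (subst add.commute) (simp add: binomial_ring)
  also have "\<dots> = 1 + (\<Sum>i<p. of_nat (p choose Suc i) * x ^ Suc i)"
    by (subst sum.atMost_shift) simp
  also have "(\<Sum>i<p. of_nat (p choose Suc i) * x ^ Suc i) = ipoly (shifted_cyclotomic p) x * x"
    by (simp add: shifted_cyclotomic_def ipoly_sum sum_distrib_left map_poly_monom poly_monom mult_ac)
  finally show ?thesis by simp
qed

section \<open>Relations between the powers of a root of unity\<close>

lemma root_unity_power: "0 < t \<Longrightarrow> root_unity t ^ t = 1"
  unfolding root_unity_def by (simp flip: exp_of_nat_mult)

lemma root_unity_neq_1:
  assumes "2 \<le> t"
  shows "root_unity t \<noteq> 1"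
proof
  assume "root_unity t = 1"
  then have "cis (2 * pi * real 1 / real t) = cis (2 * pi * real 0 / real t)"
    by (simp add: root_unity_def cis_conv_exp mult.commute)
  moreover have "inj_on (\<lambda>k. cis (2 * pi * real k / real t)) {..<t}"
    using bij_betw_roots_unity[of t] assms by (simp add: bij_betw_def)
  ultimately show False
    using assms by (auto dest: inj_onD[of _ _ 1 0])
qed

lemma sum_root_unity:
  assumes "2 \<le> t"
  shows "(\<Sum>s<t. root_unity t ^ s) = 0"
  using root_unity_neq_1[OF assms] root_unity_power[of t] assms by (simp add: sum_gp_strict)

text \<open>Any relation yields a polynomial of degree below \<open>t - 1\<close> vanishing at the
  root of unity. Composed with \<open>1 + X\<close>, it shares a root with the irreducible shifted
  cyclotomic polynomial of degree \<open>t - 1\<close>, so it is zero.\<close>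

lemma prime_root_unity_independent:
  fixes c :: "nat \<Rightarrow> int"
  assumes "prime t" and sum0: "(\<Sum>s<t. of_int (c s) * root_unity t ^ s) = 0" and "s < t"
  shows "c s = c (t - 1)"
proof -
  have t: "2 \<le> t"
    using \<open>prime t\<close> by (rule prime_ge_2_nat)
  \<comment> \<open>Subtracting \<open>c (t - 1)\<close> throughout removes the top coefficient and
    keeps the root, since the powers sum to 0.\<close>
  define f where "f = (\<Sum>s<t. monom (c s - c (t - 1)) s)"
  have coeff_f: "coeff f i = (if i < t then c i - c (t - 1) else 0)" for i
    by (simp add: f_def coeff_sum)
  have "ipoly f (root_unity t) =
      (\<Sum>s<t. of_int (c s) * root_unity t ^ s) - of_int (c (t - 1)) * (\<Sum>s<t. root_unity t ^ s)"
    by (simp add: f_def ipoly_sum map_poly_monom poly_monom sum_subtractf sum_distrib_left left_diff_distrib)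
  then have f_root: "ipoly f (root_unity t) = 0"
    by (simp add: sum0 sum_root_unity[OF t])
  have "degree f \<le> t - 2"
  proof (rule degree_le, intro allI impI)
    fix i assume "t - 2 < i"
    then show "coeff f i = 0"
      using t by (cases "i = t - 1") (auto simp: coeff_f)
  qed
  then have deg_f: "degree f < t - 1"
    using t by simp
  let ?x = "root_unity t - 1"
  have "ipoly (shifted_cyclotomic t) ?x * ?x = 0"
    using t by (simp only: shifted_cyclotomic_mult) (simp add: root_unity_power)
  then have root: "ipoly (shifted_cyclotomic t) ?x = 0"
    using root_unity_neq_1[OF t] by simp
  have "ipoly (pcompose f [:1, 1:]) ?x = 0"
    by (simp add: ipoly_pcompose map_poly_pCons f_root)
  then have "pcompose f [:1, 1:] = 0"
    using irreducible_min_degree[OF irreducible_shifted_cyclotomic[OF \<open>prime t\<close>] root]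
      deg_f t by (fastforce simp: degree_shifted_cyclotomic degree_pcompose)
  then have "f = 0"
    by (simp add: pcompose_eq_0_iff)
  then show ?thesis
    using coeff_f[of s] \<open>s < t\<close> by simp
qed

subsection \<open>Generating functions of sets with prescribed residue counts\<close>

definition weight_gf :: "'b set \<Rightarrow> ('b \<Rightarrow> nat) \<Rightarrow> complex fps" where
  "weight_gf A w = Abs_fps (\<lambda>n. of_nat (card {a \<in> A. w a = n}))"

text \<open>Since \<open>card\<close> is 0 on infinite sets, the coefficients of
  \<open>weight_gf\<close> are true counts only under this condition.\<close>

definition finite_fibres :: "'b set \<Rightarrow> ('b \<Rightarrow> nat) \<Rightarrow> bool" where
  "finite_fibres A w \<longleftrightarrow> (\<forall>n. finite {a \<in> A. w a = n})"

lemma weight_gf_empty [simp]: "weight_gf {} w = 0"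
  by (simp add: weight_gf_def fps_eq_iff)

lemma weight_gf_bij:
  assumes "bij_betw f A B" and "\<And>a. a \<in> A \<Longrightarrow> w' (f a) = w a"
  shows "weight_gf A w = weight_gf B w'"
proof -
  have "bij_betw f {a \<in> A. w a = n} {b \<in> B. w' b = n}" for n
    using assms by (auto simp: bij_betw_def inj_on_def image_iff)
  then have "card {a \<in> A. w a = n} = card {b \<in> B. w' b = n}" for n
    by (rule bij_betw_same_card)
  then show ?thesis
    by (simp add: weight_gf_def)
qed

lemma weight_gf_add: "weight_gf A (\<lambda>a. w a + c) = fps_X ^ c * weight_gf A w"
proof (rule fps_ext)
  fix n
  have "{a \<in> A. w a + c = n} = (if n < c then {} else {a \<in> A. w a = n - c})"
    by auto
  then show "fps_nth (weight_gf A (\<lambda>a. w a + c)) n = fps_nth (fps_X ^ c * weight_gf A w) n"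
    by (simp add: weight_gf_def fps_X_power_mult_nth)
qed

lemma weight_gf_Un:
  assumes "finite_fibres A w" "finite_fibres B w" "A \<inter> B = {}"
  shows "weight_gf (A \<union> B) w = weight_gf A w + weight_gf B w"
proof (rule fps_ext)
  fix n
  have "{a \<in> A \<union> B. w a = n} = {a \<in> A. w a = n} \<union> {a \<in> B. w a = n}"
    by auto
  then show "fps_nth (weight_gf (A \<union> B) w) n = fps_nth (weight_gf A w + weight_gf B w) n"
    using assms by (simp add: weight_gf_def finite_fibres_def card_Un_disjoint disjoint_iff)
qed

text \<open>Splitting a fibre by the weight of the first component gives the Cauchy product.\<close>

lemma weight_gf_times:
  assumes "finite_fibres A v" "finite_fibres B w"
  shows "weight_gf (A \<times> B) (\<lambda>(a, b). v a + w b) = weight_gf A v * weight_gf B w"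
proof (rule fps_ext)
  fix n
  have "{p \<in> A \<times> B. (case p of (a, b) \<Rightarrow> v a + w b) = n} =
      (\<Union>i\<in>{0..n}. {a \<in> A. v a = i} \<times> {b \<in> B. w b = n - i})"
    by auto
  also have "card \<dots> = (\<Sum>i = 0..n. card ({a \<in> A. v a = i} \<times> {b \<in> B. w b = n - i}))"
    using assms by (intro card_UN_disjoint) (auto simp: finite_fibres_def)
  finally show "fps_nth (weight_gf (A \<times> B) (\<lambda>(a, b). v a + w b)) n =
      fps_nth (weight_gf A v * weight_gf B w) n"
    by (simp add: weight_gf_def fps_mult_nth card_cartesian_product)
qed

lemma finite_fibres_subset: "finite_fibres B w \<Longrightarrow> A \<subseteq> B \<Longrightarrow> finite_fibres A w"
  unfolding finite_fibres_def
  by (intro allI, rule finite_subset[of _ "{a \<in> B. w a = _}"]) auto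

lemma finite_fibres_Sum:
  assumes "\<And>X. X \<in> A \<Longrightarrow> finite X"
  shows "finite_fibres A Sum"
  unfolding finite_fibres_def
proof
  fix n
  have "x \<le> \<Sum> X" if "finite X" "x \<in> X" for x :: nat and X
    using that member_le_sum[of x X "\<lambda>x. x"] by simp
  then have "{X \<in> A. \<Sum> X = n} \<subseteq> Pow {..n}"
    using assms by auto
  then show "finite {X \<in> A. \<Sum> X = n}"
    by (rule finite_subset) simp
qed

section \<open>Finite sets of natural numbers by cardinality\<close>

definition card_sets :: "nat \<Rightarrow> nat set set" where
  "card_sets m = {X. finite X \<and> card X = m}"

lemma image_Suc_vimage_Suc: "Suc ` (Suc -` X) = X - {0}"
  using not0_implies_Suc by (fastforce simp: image_vimage_eq)

text \<open>A set is determined by whether it contains 0 and by its positive elements, lowered by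
  one.\<close>

lemma card_sets_Suc:
  "card_sets (Suc m) = (\<lambda>X. insert 0 (Suc ` X)) ` card_sets m \<union> image Suc ` card_sets (Suc m)"
proof (intro equalityI subsetI)
  fix X assume "X \<in> card_sets (Suc m)"
  then have X: "finite X" "card X = Suc m"
    by (auto simp: card_sets_def)
  define Y where "Y = Suc -` X"
  have finY: "finite Y"
    unfolding Y_def using X(1) by (intro finite_vimageI) auto
  show "X \<in> (\<lambda>X. insert 0 (Suc ` X)) ` card_sets m \<union> image Suc ` card_sets (Suc m)"
  proof (cases "0 \<in> X")
    case True
    then have "X = insert 0 (Suc ` Y)"
      unfolding Y_def image_Suc_vimage_Suc by auto
    moreover from this have "Y \<in> card_sets m"
      using X(2) finY by (simp add: card_sets_def card_image)
    ultimately show ?thesis by blast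
  next
    case False
    then have "X = Suc ` Y"
      unfolding Y_def image_Suc_vimage_Suc by auto
    moreover from this have "Y \<in> card_sets (Suc m)"
      using X(2) finY by (simp add: card_sets_def card_image)
    ultimately show ?thesis by blast
  qed
qed (auto simp: card_sets_def card_image)

lemma insert_0_image_Suc_inject: "insert 0 (Suc ` A) = insert 0 (Suc ` B) \<longleftrightarrow> A = B"
  by (metis inj_Suc inj_image_eq_iff insert_ident zero_notin_Suc_image)

lemma sum_image_Suc: "\<Sum> (Suc ` A) = \<Sum> A + card A"
  by (cases "finite A") (simp_all add: sum.reindex sum_Suc finite_image_iff)

text \<open>Raising \<open>m\<close> elements by one adds \<open>m\<close> to their sum, so the two
  cases of \<open>card_sets_Suc\<close> contribute \<open>fps_X ^ (t * m)\<close> times the series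
  for \<open>m\<close> and \<open>fps_X ^ (t * Suc m)\<close> times the series for
  \<open>Suc m\<close>.\<close>

lemma weight_gf_card_sets_Suc:
  assumes "0 < t"
  shows "weight_gf (card_sets (Suc m)) (\<lambda>X. t * \<Sum> X) * (1 - fps_X ^ (t * Suc m)) =
    fps_X ^ (t * m) * weight_gf (card_sets m) (\<lambda>X. t * \<Sum> X)"
proof -
  let ?w = "\<lambda>X. t * \<Sum> X"
  let ?A = "(\<lambda>X. insert 0 (Suc ` X)) ` card_sets m" and ?B = "image Suc ` card_sets (Suc m)"
  have fin: "finite_fibres (card_sets m) ?w" for m
    unfolding finite_fibres_def
  proof
    fix n
    have "finite {X \<in> card_sets m. \<Sum> X = n div t}"
      using finite_fibres_Sum[of "card_sets m"] by (auto simp: finite_fibres_def card_sets_def)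
    then show "finite {X \<in> card_sets m. t * \<Sum> X = n}"
      by (rule rev_finite_subset) (use assms in auto)
  qed
  have sub: "?A \<subseteq> card_sets (Suc m)" "?B \<subseteq> card_sets (Suc m)"
    using card_sets_Suc[of m] by (blast, blast)
  have "weight_gf (card_sets (Suc m)) ?w = weight_gf ?A ?w + weight_gf ?B ?w"
    by (subst card_sets_Suc, rule weight_gf_Un)
      (auto intro: finite_fibres_subset[OF fin sub(1)] finite_fibres_subset[OF fin sub(2)])
  also have "weight_gf ?A ?w = weight_gf (card_sets m) (\<lambda>X. t * \<Sum> X + t * m)"
    by (rule weight_gf_bij[symmetric, of "\<lambda>X. insert 0 (Suc ` X)"])
      (auto simp: bij_betw_def inj_on_def insert_0_image_Suc_inject sum_image_Suc card_sets_def
        algebra_simps)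
  also have "weight_gf ?B ?w = weight_gf (card_sets (Suc m)) (\<lambda>X. t * \<Sum> X + t * Suc m)"
    by (rule weight_gf_bij[symmetric, of "image Suc"])
      (auto simp: bij_betw_def inj_on_def inj_image_eq_iff sum_image_Suc card_sets_def
        algebra_simps)
  finally show ?thesis
    by (simp only: weight_gf_add) (simp add: algebra_simps)
qed

lemma weight_gf_singleton: "weight_gf {a} w = fps_X ^ w a"
proof (rule fps_ext)
  fix n
  have "{b \<in> {a}. w b = n} = (if n = w a then {a} else {})"
    by auto
  then show "fps_nth (weight_gf {a} w) n = fps_nth (fps_X ^ w a) n"
    by (simp add: weight_gf_def fps_X_power_nth)
qed

lemma qpoch_Suc: "qpoch q q (Suc m) = qpoch q q m * (1 - q ^ Suc m)"
  by (simp add: qpoch_def)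

text \<open>Iterates the recursion; the remaining power of \<open>fps_X\<close> is the weight of the
  smallest set \<open>{..<m}\<close>.\<close>

lemma weight_gf_card_sets:
  assumes "0 < t"
  shows "weight_gf (card_sets m) (\<lambda>X. t * \<Sum> X) * qpoch (fps_X ^ t) (fps_X ^ t) m =
    fps_X ^ (t * \<Sum> {..<m})"
proof (induction m)
  case 0
  have "card_sets 0 = {{}}"
    by (auto simp: card_sets_def)
  then show ?case
    by (simp add: weight_gf_singleton qpoch_def)
next
  case (Suc m)
  let ?F = "\<lambda>m. weight_gf (card_sets m) (\<lambda>X. t * \<Sum> X)" and ?P = "qpoch (fps_X ^ t :: complex fps) (fps_X ^ t)"
  have "?F (Suc m) * ?P (Suc m) = (?F (Suc m) * (1 - fps_X ^ (t * Suc m))) * ?P m"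
    by (simp only: qpoch_Suc flip: power_mult) (simp only: mult_ac)
  also have "\<dots> = fps_X ^ (t * m) * (?F m * ?P m)"
    by (simp only: weight_gf_card_sets_Suc[OF assms] mult.assoc)
  also have "\<dots> = fps_X ^ (t * \<Sum> {..<Suc m})"
    by (simp only: Suc.IH flip: power_add) (simp add: algebra_simps)
  finally show ?case .
qed

text \<open>The q-Pochhammer symbol has constant term 1 and is therefore invertible.\<close>

lemma recip_qpoch_eq:
  assumes "0 < t" and "A * qpoch (fps_X ^ t) (fps_X ^ t) m = B"
  shows "A = B * recip_qpoch (fps_X ^ t) (int m)"
proof -
  have "fps_nth (qpoch (fps_X ^ t) (fps_X ^ t) m :: complex fps) 0 = 1"
    using assms(1) by (induction m) (simp_all add: qpoch_def fps_mult_nth_0 fps_X_power_nth flip: power_mult power_add)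
  then have "qpoch (fps_X ^ t) (fps_X ^ t) m * inverse (qpoch (fps_X ^ t) (fps_X ^ t) m :: complex fps) = 1"
    by (intro inverse_mult_eq_1') auto
  then show ?thesis
    using assms(2) by (auto simp: recip_qpoch_def mult.assoc)
qed

definition residue_sets :: "nat \<Rightarrow> nat set \<Rightarrow> (nat \<Rightarrow> nat) \<Rightarrow> nat set set" where
  "residue_sets t R m =
    {X. finite X \<and> (\<forall>x\<in>X. x mod t \<in> R) \<and> (\<forall>r\<in>R. card {x \<in> X. x mod t = r} = m r)}"

text \<open>Elements of the class are \<open>t * y + r\<close>, where \<open>y\<close> runs through
  an arbitrary set of \<open>m r\<close> numbers.\<close>

lemma weight_gf_one_residue:
  assumes "r < t"
  shows "weight_gf (residue_sets t {r} m) Sum =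
    fps_X ^ (r * m r + t * \<Sum> {..<m r}) * recip_qpoch (fps_X ^ t) (int (m r))"
proof -
  let ?g = "\<lambda>y. t * y + r"
  have inj_on: "inj_on ?g X" for X
    using assms by (auto simp: inj_on_def)
  then have inj: "inj ?g" .
  have sets: "residue_sets t {r} m = {X. finite X \<and> (\<forall>x\<in>X. x mod t = r) \<and> card X = m r}"
    unfolding residue_sets_def by (auto cong: conj_cong simp: Collect_conj_eq)
  have "bij_betw (image ?g) (card_sets (m r)) (residue_sets t {r} m)"
  proof (rule bij_betw_imageI)
    show "inj_on (image ?g) (card_sets (m r))"
      using inj by (simp add: inj_on_def inj_image_eq_iff)
    show "image ?g ` card_sets (m r) = residue_sets t {r} m"
    proof (intro equalityI subsetI)
      fix X assume "X \<in> residue_sets t {r} m"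
      then have X: "finite X" "card X = m r" "\<And>x. x \<in> X \<Longrightarrow> x mod t = r"
        by (auto simp: sets)
      have "X = ?g ` ((\<lambda>x. x div t) ` X)"
        unfolding image_image using X(3) by (force simp: image_iff)
      moreover from this have "card ((\<lambda>x. x div t) ` X) = m r"
        using X(2) by (metis card_image inj_on)
      ultimately show "X \<in> image ?g ` card_sets (m r)"
        using X(1) by (auto simp: card_sets_def)
    next
      fix X assume "X \<in> image ?g ` card_sets (m r)"
      then show "X \<in> residue_sets t {r} m"
        using assms by (auto simp: sets card_sets_def card_image[OF inj_on])
    qed
  qed
  moreover have "\<Sum> (?g ` X) = t * \<Sum> X + r * m r" if "X \<in> card_sets (m r)" for X
    using that
    by (subst sum.reindex[OF inj_on]) (simp add: card_sets_def sum.distrib sum_distrib_left)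
  ultimately have "weight_gf (residue_sets t {r} m) Sum = weight_gf (card_sets (m r)) (\<lambda>X. t * \<Sum> X + r * m r)"
    by (intro weight_gf_bij[symmetric]) auto
  also have "\<dots> = fps_X ^ (r * m r) * weight_gf (card_sets (m r)) (\<lambda>X. t * \<Sum> X)"
    by (rule weight_gf_add)
  also have "weight_gf (card_sets (m r)) (\<lambda>X. t * \<Sum> X) =
      fps_X ^ (t * \<Sum> {..<m r}) * recip_qpoch (fps_X ^ t) (int (m r))"
    using assms by (intro recip_qpoch_eq weight_gf_card_sets) auto
  finally show ?thesis
    by (simp add: power_add mult.assoc)
qed

text \<open>A set splits uniquely into its part in the class of \<open>r\<close> and its part in the
  classes of \<open>R\<close>; the sums add up.\<close>

lemma weight_gf_residue_sets_insert:
  assumes "r \<notin> R"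
  shows "weight_gf (residue_sets t (insert r R) m) Sum =
    weight_gf (residue_sets t {r} m) Sum * weight_gf (residue_sets t R m) Sum"
proof -
  let ?C = "residue_sets t (insert r R) m" and ?A = "residue_sets t {r} m" and ?B = "residue_sets t R m"
  have "bij_betw (\<lambda>(X, Y). X \<union> Y) (?A \<times> ?B) ?C"
  proof (rule bij_betw_byWitness[where f' = "\<lambda>X. ({x \<in> X. x mod t = r}, {x \<in> X. x mod t \<in> R})"])
    show "\<forall>p\<in>?A \<times> ?B. (\<lambda>X. ({x \<in> X. x mod t = r}, {x \<in> X. x mod t \<in> R})) ((\<lambda>(X, Y). X \<union> Y) p) = p"
      using assms by (auto simp: residue_sets_def)
    show "\<forall>X\<in>?C. (\<lambda>(X, Y). X \<union> Y) ({x \<in> X. x mod t = r}, {x \<in> X. x mod t \<in> R}) = X"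
      by (auto simp: residue_sets_def)
    show "(\<lambda>(X, Y). X \<union> Y) ` (?A \<times> ?B) \<subseteq> ?C"
    proof clarify
      fix X Y assume X: "X \<in> ?A" and Y: "Y \<in> ?B"
      have "{x \<in> X \<union> Y. x mod t = r} = {x \<in> X. x mod t = r}"
        using X Y assms by (auto simp: residue_sets_def)
      moreover have "{x \<in> X \<union> Y. x mod t = s} = {x \<in> Y. x mod t = s}" if "s \<in> R" for s
        using X Y assms that by (auto simp: residue_sets_def)
      ultimately show "X \<union> Y \<in> ?C"
        using X Y by (auto simp: residue_sets_def)
    qed
    show "(\<lambda>X. ({x \<in> X. x mod t = r}, {x \<in> X. x mod t \<in> R})) ` ?C \<subseteq> ?A \<times> ?B"
    proof clarify
      fix X assume X: "X \<in> ?C"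
      have "{x \<in> {x \<in> X. x mod t = r}. x mod t = r} = {x \<in> X. x mod t = r}"
        by auto
      moreover have "{x \<in> {x \<in> X. x mod t \<in> R}. x mod t = s} = {x \<in> X. x mod t = s}" if "s \<in> R" for s
        using that by auto
      ultimately show "{x \<in> X. x mod t = r} \<in> ?A \<and> {x \<in> X. x mod t \<in> R} \<in> ?B"
        using X by (auto simp: residue_sets_def)
    qed
  qed
  moreover have "\<Sum> (X \<union> Y) = \<Sum> X + \<Sum> Y" if "X \<in> ?A" "Y \<in> ?B" for X Y
    using that assms by (intro sum.union_disjoint) (auto simp: residue_sets_def)
  ultimately have "weight_gf ?C Sum = weight_gf (?A \<times> ?B) (\<lambda>(X, Y). \<Sum> X + \<Sum> Y)"
    by (intro weight_gf_bij[symmetric]) auto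
  also have "\<dots> = weight_gf ?A Sum * weight_gf ?B Sum"
    by (intro weight_gf_times finite_fibres_Sum) (auto simp: residue_sets_def)
  finally show ?thesis .
qed

lemma weight_gf_residue_sets:
  assumes "finite R" "R \<subseteq> {..<t}"
  shows "weight_gf (residue_sets t R m) Sum =
    fps_X ^ (\<Sum>r\<in>R. r * m r + t * \<Sum> {..<m r}) * (\<Prod>r\<in>R. recip_qpoch (fps_X ^ t) (int (m r)))"
  using assms
proof (induction R)
  case empty
  have "residue_sets t {} m = {{}}"
    by (auto simp: residue_sets_def)
  then show ?case
    by (simp add: weight_gf_singleton)
next
  case (insert r R)
  then have "weight_gf (residue_sets t (insert r R) m) Sum =
      fps_X ^ (r * m r + t * \<Sum> {..<m r}) * recip_qpoch (fps_X ^ t) (int (m r)) *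
      (fps_X ^ (\<Sum>r\<in>R. r * m r + t * \<Sum> {..<m r}) *
        (\<Prod>r\<in>R. recip_qpoch (fps_X ^ t) (int (m r))))"
    by (subst weight_gf_residue_sets_insert, simp, subst weight_gf_one_residue) auto
  with insert.hyps show ?case
    by (simp add: power_add mult_ac)
qed

subsection \<open>Beta-sets of partitions\<close>

definition bounded_partitions :: "nat \<Rightarrow> nat list set" where
  "bounded_partitions M = {xs \<in> partitions. largest_part xs \<le> M}"

lemma bounded_partitions_iff:
  "xs \<in> bounded_partitions M \<longleftrightarrow> sorted_wrt (\<ge>) xs \<and> set xs \<subseteq> {1..M}"
  by (auto simp: bounded_partitions_def partitions_def largest_part_def Suc_le_eq)

text \<open>
  If \<open>c 1 \<ge> \<dots> \<ge> c M\<close> are the column lengths of the partition, padded with zeros, this is the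
  set of the beta-numbers \<open>c j + M - j\<close>. A first row of maximal length \<open>M\<close> contributes 1 to every column;
  otherwise the last column is empty and contributes the beta-number 0.
\<close>

fun beta_set :: "nat \<Rightarrow> nat list \<Rightarrow> nat set" where
  "beta_set 0 xs = {}"
| "beta_set (Suc M) [] = insert 0 (Suc ` beta_set M [])"
| "beta_set (Suc M) (x # xs) =
    (if x = Suc M then Suc ` beta_set (Suc M) xs else insert 0 (Suc ` beta_set M (x # xs)))"

lemma finite_beta_set [simp]: "finite (beta_set M xs)"
  by (induction M xs rule: beta_set.induct) auto

lemma card_beta_set [simp]: "card (beta_set M xs) = M"
  by (induction M xs rule: beta_set.induct) (auto simp: card_image card_insert_if)

lemma bounded_partitions_0: "xs \<in> bounded_partitions 0 \<longleftrightarrow> xs = []"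
  by (auto simp: bounded_partitions_iff)

lemma bounded_partitions_Nil [simp]: "[] \<in> bounded_partitions M"
  by (auto simp: bounded_partitions_iff)

lemma bounded_partitions_Cons_max:
  "Suc M # xs \<in> bounded_partitions (Suc M) \<longleftrightarrow> xs \<in> bounded_partitions (Suc M)"
  by (auto simp: bounded_partitions_iff)

lemma bounded_partitions_Cons_less:
  "x # xs \<in> bounded_partitions (Suc M) \<Longrightarrow> x \<noteq> Suc M \<Longrightarrow> x # xs \<in> bounded_partitions M"
  by (auto simp: bounded_partitions_iff subset_iff) force+

lemma bounded_partitions_mono: "M \<le> M' \<Longrightarrow> bounded_partitions M \<subseteq> bounded_partitions M'"
  by (auto simp: bounded_partitions_def)

text \<open>Removing a full row lowers all beta-numbers by one, which accounts for its length.
  Dropping an empty last column lowers the other \<open>M\<close> by one, the difference of the two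
  triangular numbers.\<close>

lemma sum_beta_set:
  "xs \<in> bounded_partitions M \<Longrightarrow> \<Sum> (beta_set M xs) = sum_list xs + \<Sum> {..<M}"
proof (induction M xs rule: beta_set.induct)
  case (3 M x xs)
  then show ?case
    by (cases "x = Suc M")
      (auto simp: sum_image_Suc bounded_partitions_Cons_max dest: bounded_partitions_Cons_less)
qed (auto simp: bounded_partitions_0 sum_image_Suc)

lemma zero_in_beta_set: "0 \<in> beta_set (Suc M) xs \<longleftrightarrow> (\<forall>ys. xs \<noteq> Suc M # ys)"
  by (cases xs) auto

lemma beta_set_Suc:
  "(\<forall>ys. xs \<noteq> Suc M # ys) \<Longrightarrow> beta_set (Suc M) xs = insert 0 (Suc ` beta_set M xs)"
  by (cases xs) auto

lemma bounded_partitions_Suc: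
  "(\<forall>ys. xs \<noteq> Suc M # ys) \<Longrightarrow> xs \<in> bounded_partitions (Suc M) \<Longrightarrow> xs \<in> bounded_partitions M"
  by (cases xs) (auto dest: bounded_partitions_Cons_less)

text \<open>Membership of 0 reveals which case of the recursion applies, so it can be undone; each
  step lowers the width bound or the number of rows.\<close>

lemma beta_set_inject:
  "beta_set M xs = beta_set M ys \<Longrightarrow> xs \<in> bounded_partitions M \<Longrightarrow> ys \<in> bounded_partitions M
    \<Longrightarrow> xs = ys"
proof (induction "M + length xs" arbitrary: M xs ys rule: less_induct)
  case less
  show ?case
  proof (cases M)
    case 0
    then show ?thesis
      using less.prems by (simp add: bounded_partitions_0)
  next
    case (Suc N)
    show ?thesis
    proof (cases "0 \<in> beta_set M xs")
      case True
      then have x: "\<forall>zs. xs \<noteq> Suc N # zs" and y: "\<forall>zs. ys \<noteq> Suc N # zs"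
        using less.prems(1) zero_in_beta_set unfolding Suc by metis+
      then have "beta_set N xs = beta_set N ys"
        using less.prems(1) unfolding Suc by (simp add: beta_set_Suc insert_0_image_Suc_inject)
      then show ?thesis
        using less.hyps[of N xs ys] less.prems(2,3) x y
        unfolding Suc by (simp add: bounded_partitions_Suc)
    next
      case False
      then obtain xs' ys' where xy: "xs = Suc N # xs'" "ys = Suc N # ys'"
        using less.prems(1) zero_in_beta_set unfolding Suc by metis
      then have "beta_set M xs' = beta_set M ys'"
        using less.prems(1) unfolding Suc by (simp add: inj_image_eq_iff)
      then show ?thesis
        using less.hyps[of M xs' ys'] less.prems(2,3) xy
        unfolding Suc by (simp add: bounded_partitions_Cons_max)
    qed
  qed
qed

text \<open>The recursion run backwards: remove 0 if present and lower all other elements by one,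
  which decreases \<open>M + \<Sum> X\<close>.\<close>

lemma beta_set_surj:
  "finite X \<Longrightarrow> card X = M \<Longrightarrow> \<exists>xs\<in>bounded_partitions M. beta_set M xs = X"
proof (induction "M + \<Sum> X" arbitrary: M X rule: less_induct)
  case less
  show ?case
  proof (cases M)
    case 0
    then show ?thesis
      using less.prems by (auto simp: bounded_partitions_0)
  next
    case (Suc N)
    define Y where "Y = Suc -` X"
    have finY: "finite Y"
      unfolding Y_def using less.prems(1) by (intro finite_vimageI) auto
    show ?thesis
    proof (cases "0 \<in> X")
      case True
      then have X: "X = insert 0 (Suc ` Y)"
        unfolding Y_def image_Suc_vimage_Suc by auto
      then have "card Y = N"
        using less.prems(2) finY by (simp add: card_image Suc)
      moreover have "N + \<Sum> Y < M + \<Sum> X"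
        using finY by (simp add: X sum_image_Suc Suc)
      ultimately obtain xs where xs: "xs \<in> bounded_partitions N" "beta_set N xs = Y"
        using less.hyps finY by blast
      then have "\<forall>ys. xs \<noteq> Suc N # ys"
        by (auto simp: bounded_partitions_iff)
      then have "beta_set M xs = X"
        using xs by (simp add: Suc X beta_set_Suc)
      moreover have "xs \<in> bounded_partitions M"
        using xs(1) bounded_partitions_mono[of N M] Suc by auto
      ultimately show ?thesis by blast
    next
      case False
      then have X: "X = Suc ` Y"
        unfolding Y_def image_Suc_vimage_Suc by auto
      then have "card Y = M"
        using less.prems(2) finY by (simp add: card_image)
      moreover have "M + \<Sum> Y < M + \<Sum> X"
        using finY \<open>card Y = M\<close> by (simp add: X sum_image_Suc Suc)
      ultimately obtain xs where xs: "xs \<in> bounded_partitions M" "beta_set M xs = Y"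
        using less.hyps finY by blast
      then have "beta_set M (M # xs) = X" "M # xs \<in> bounded_partitions M"
        by (simp_all add: Suc X bounded_partitions_Cons_max)
      then show ?thesis by blast
    qed
  qed
qed

lemma bij_betw_beta_set:
  "bij_betw (beta_set M) (bounded_partitions M) (card_sets M)"
  unfolding bij_betw_def
  using beta_set_inject beta_set_surj by (fastforce simp: inj_on_def image_iff card_sets_def)

section \<open>Labels of cells and residues of beta-numbers\<close>

definition residue_count :: "nat \<Rightarrow> int \<Rightarrow> nat set \<Rightarrow> int" where
  "residue_count t c A = (\<Sum>x\<in>A. of_bool (int t dvd int x - c))"

lemma residue_count_image_Suc: "residue_count t c (Suc ` A) = residue_count t (c - 1) A"
  by (simp add: residue_count_def sum.reindex algebra_simps)

lemma residue_count_insert_0: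
  "finite A \<Longrightarrow> residue_count t c (insert 0 (Suc ` A)) =
    of_bool (int t dvd c) + residue_count t (c - 1) A"
  by (subst residue_count_image_Suc[symmetric]) (simp add: residue_count_def)

text \<open>Lowering the elements by one turns the residue \<open>c + 1\<close> into
  \<open>c\<close> and the interval into one from -1 to \<open>x - 2\<close>; only the end points -1
  and \<open>x - 1\<close> make a difference.\<close>

lemma residue_count_shift:
  "residue_count t (c + 1) {..<x} =
    residue_count t c {..<x} + of_bool (int t dvd c + 1) - of_bool (int t dvd int x - (c + 1))"
proof (induction x)
  case 0
  show ?case
    using dvd_minus_iff[of "int t" "c + 1"] by (simp add: residue_count_def)
qed (simp add: residue_count_def)

text \<open>
  Unlike \<open>r_count\<close>, the label ranges over all integers, so that removing the first row is the
  shift \<open>c \<mapsto> c + 1\<close>.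
\<close>

definition label_count :: "nat \<Rightarrow> int \<Rightarrow> nat list \<Rightarrow> nat" where
  "label_count t c xs = card {p \<in> young_diagram xs. int t dvd int (snd p) - int (fst p) - c}"

lemma finite_young_diagram [simp]: "finite (young_diagram xs)"
proof (rule finite_subset)
  show "young_diagram xs \<subseteq> (SIGMA i:{1..length xs}. {1..xs ! (i - 1)})"
    by (auto simp: young_diagram_def)
qed auto

lemma young_diagram_Nil [simp]: "young_diagram [] = {}"
  by (auto simp: young_diagram_def)

lemma young_diagram_Cons:
  "young_diagram (x # xs) = Pair 1 ` {1..x} \<union> map_prod Suc id ` young_diagram xs"
proof (intro set_eqI)
  fix p :: "nat \<times> nat"
  obtain i j where p: "p = (i, j)" by (cases p)
  show "p \<in> young_diagram (x # xs) \<longleftrightarrow> p \<in> Pair 1 ` {1..x} \<union> map_prod Suc id ` young_diagram xs"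
  proof (cases "i \<le> 1")
    case True
    then show ?thesis
      by (auto simp: p young_diagram_def)
  next
    case False
    then obtain i' where "i = Suc (Suc i')"
      by (metis One_nat_def le_SucI le_refl not0_implies_Suc zero_le)
    then show ?thesis
      by (force simp: p young_diagram_def image_iff map_prod_def)
  qed
qed

text \<open>Column minus row runs from 0 to \<open>x - 1\<close> in the first row, and drops by one
  when the other rows move down.\<close>

lemma label_count_Cons:
  "int (label_count t c (x # xs)) = residue_count t c {..<x} + int (label_count t (c + 1) xs)"
proof -
  let ?f = "\<lambda>p. of_bool (int t dvd int (snd p) - int (fst p) - c) :: int"
  have count: "int (label_count t c xs) =
      (\<Sum>p\<in>young_diagram xs. of_bool (int t dvd int (snd p) - int (fst p) - c))" for c xs
    by (simp add: label_count_def Int_def flip: sum.inter_filter)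
  have disj: "Pair 1 ` {1..x} \<inter> map_prod Suc id ` young_diagram xs = {}"
    by (auto simp: young_diagram_def)
  have "int (label_count t c (x # xs)) = sum ?f (Pair 1 ` {1..x}) + sum ?f (map_prod Suc id ` young_diagram xs)"
    unfolding count young_diagram_Cons using disj by (intro sum.union_disjoint) auto
  also have "sum ?f (Pair 1 ` {1..x}) = residue_count t c {..<x}"
  proof -
    have "{1..x} = Suc ` {..<x}"
      by (auto simp: image_iff) (metis Suc_le_D Suc_le_lessD lessThan_iff)
    then show ?thesis
      by (simp add: residue_count_def sum.reindex inj_on_def del: sum_of_bool_eq)
  qed
  also have "sum ?f (map_prod Suc id ` young_diagram xs) = int (label_count t (c + 1) xs)"
    unfolding count by (subst sum.reindex) (auto simp: inj_on_def algebra_simps)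
  finally show ?thesis .
qed

text \<open>Down a column the labels decrease by one, so the difference telescopes to the top cell
  and the place just below the column. These correspond to the beta-numbers of the empty and of the
  actual column. The induction follows the recursion of \<open>beta_set\<close> instead of the
  columns.\<close>

lemma label_count_diff:
  "xs \<in> bounded_partitions M \<Longrightarrow>
    int (label_count t c xs) - int (label_count t (c + 1) xs) =
      residue_count t (int M - 1 - c) {..<M} - residue_count t (int M - 1 - c) (beta_set M xs)"
proof (induction M xs arbitrary: c rule: beta_set.induct)
  case (1 xs)
  then show ?case
    by (simp add: bounded_partitions_0 label_count_def residue_count_def)
next
  case (2 M)
  have "{..<Suc M} = insert 0 (Suc ` {..<M})"
    by (rule lessThan_Suc_eq_insert_0)
  then show ?case
    using "2.IH"[of c] by (simp add: residue_count_insert_0 algebra_simps)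
next
  case (3 M x xs)
  show ?case
  proof (cases "x = Suc M")
    case True
    then have xs: "xs \<in> bounded_partitions (Suc M)"
      using 3 by (simp add: bounded_partitions_Cons_max)
    \<comment> \<open>The residue that belongs to the label \<open>c + 1\<close>. As
      \<open>c + 1\<close> and \<open>m + 1\<close> add up to \<open>x\<close>, the boundary terms
      of the two uses of \<open>residue_count_shift\<close> below match.\<close>
    define m where "m = int M - c - 1"
    have x: "int x - (c + 1) = m + 1" "int x - (m + 1) = c + 1" "int (Suc M) - 1 - c = m + 1"
      "int (Suc M) - 1 - (c + 1) = m" "int x - 1 - c = m + 1"
      by (simp_all add: True m_def)
    have "int (label_count t (c + 1) xs) - int (label_count t (c + 1 + 1) xs) =
        residue_count t m {..<x} - residue_count t m (beta_set (Suc M) xs)"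
      using "3.IH"(1)[OF True xs, of "c + 1"] unfolding x True .
    moreover have "residue_count t (m + 1) (beta_set (Suc M) (x # xs)) = residue_count t m (beta_set (Suc M) xs)"
      by (simp add: True residue_count_image_Suc)
    ultimately show ?thesis
      using residue_count_shift[of t c x] residue_count_shift[of t m x]
        label_count_Cons[of t c x xs] label_count_Cons[of t "c + 1" x xs]
      unfolding x True[symmetric] by linarith
  next
    case False
    have xs: "x # xs \<in> bounded_partitions M"
      using "3.prems" False by (rule bounded_partitions_Cons_less)
    have shift: "int (Suc M) - 1 - c - 1 = int M - 1 - c"
      by simp
    have "residue_count t (int (Suc M) - 1 - c) {..<Suc M} =
        of_bool (int t dvd int (Suc M) - 1 - c) + residue_count t (int M - 1 - c) {..<M}"
      by (simp only: lessThan_Suc_eq_insert_0 residue_count_insert_0 finite_lessThan shift)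
    moreover have "residue_count t (int (Suc M) - 1 - c) (beta_set (Suc M) (x # xs)) =
        of_bool (int t dvd int (Suc M) - 1 - c) + residue_count t (int M - 1 - c) (beta_set M (x # xs))"
      using False by (simp only: beta_set.simps if_False residue_count_insert_0 finite_beta_set shift)
    ultimately show ?thesis
      using "3.IH"(2)[OF False xs, of c] by linarith
  qed
qed

lemma r_count_eq_label_count:
  assumes "s < t"
  shows "r_count s xs t = label_count t (int s) xs"
proof -
  have "a mod int t = int s \<longleftrightarrow> int t dvd a - int s" for a
    using assms mod_eq_dvd_iff[of a "int t" "int s"] by simp
  then show ?thesis
    by (simp add: r_count_def label_count_def cell_label_def)
qed

lemma label_count_add_period: "label_count t (c + int t) xs = label_count t c xs"
proof -
  have "int t dvd a - (c + int t) \<longleftrightarrow> int t dvd a - c" for a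
    using dvd_diff_right_iff[of "int t" "int t" "a - c"] dvd_add_left_iff[of "int t" "- int t" "a - c"]
    by (simp add: algebra_simps)
  then show ?thesis
    by (simp add: label_count_def)
qed

subsection \<open>The GBG-rank and residues of beta-numbers\<close>

text \<open>Absorbing \<open>k\<close> into the coefficient of the zeroth power gives a vanishing
  combination, which by independence means that all coefficients \<open>c s\<close> agree. The
  conditions compare neighbours; for \<open>s = t - 1\<close> the next label is 0 again.\<close>

lemma GBG_rank_eq_iff:
  assumes "prime t"
  shows "GBG_rank t xs = of_int k \<longleftrightarrow>
    (\<forall>s<t. int (label_count t (int s) xs) - int (label_count t (int s + 1) xs) =
      k * of_bool (s = 0) - k * of_bool (s = t - 1))"
    (is "_ \<longleftrightarrow> ?R")
proof -
  have t: "2 \<le> t"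
    using assms by (rule prime_ge_2_nat)
  define L where "L s = int (label_count t (int s) xs)" for s
  define c where "c s = L s - k * of_bool (s = 0)" for s
  have L_period: "L t = L 0"
    using label_count_add_period[of t 0 xs] by (simp add: L_def)
  have "GBG_rank t xs = (\<Sum>s<t. of_int (L s) * root_unity t ^ s)"
    unfolding GBG_rank_def using t
    by (intro sum.cong) (auto simp: L_def r_count_eq_label_count)
  also have "\<dots> = (\<Sum>s<t. of_int (c s) * root_unity t ^ s + of_int k * (of_bool (s = 0) * root_unity t ^ s))"
    by (intro sum.cong) (auto simp: c_def algebra_simps)
  also have "\<dots> = (\<Sum>s<t. of_int (c s) * root_unity t ^ s) + of_int k"
    using t by (simp add: sum.distrib sum.remove[of "{..<t}" 0] flip: sum_distrib_left)
  finally have rank: "GBG_rank t xs = of_int k \<longleftrightarrow> (\<Sum>s<t. of_int (c s) * root_unity t ^ s) = 0"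
    by simp
  have R: "?R \<longleftrightarrow> (\<forall>s<t. L s - L (Suc s) = k * of_bool (s = 0) - k * of_bool (s = t - 1))"
    by (simp add: L_def add.commute)
  show ?thesis
  proof
    assume "GBG_rank t xs = of_int k"
    then have c: "c s = c (t - 1)" if "s < t" for s
      using prime_root_unity_independent[OF assms _ that] rank by blast
    show ?R
      unfolding R
    proof (intro allI impI)
      fix s assume s: "s < t"
      show "L s - L (Suc s) = k * of_bool (s = 0) - k * of_bool (s = t - 1)"
      proof (cases "s = t - 1")
        case True
        then show ?thesis
          using c[of 0] t L_period by (auto simp: c_def)
      next
        case False
        then show ?thesis
          using c[of s] c[of "Suc s"] s by (auto simp: c_def split: if_splits)
      qed
    qed
  next
    assume ?R
    then have L: "L s - L (Suc s) = k * of_bool (s = 0) - k * of_bool (s = t - 1)" if "s < t" for s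
      using that unfolding R by blast
    have "c (Suc s) = c s" if "Suc s < t" for s
    proof -
      from that have "s < t" "s \<noteq> t - 1" by auto
      with L[of s] show ?thesis
        by (simp add: c_def)
    qed
    then have c: "c s = c 0" if "s < t" for s
      using that by (induction s) auto
    have "(\<Sum>s<t. of_int (c s) * root_unity t ^ s) = of_int (c 0) * (\<Sum>s<t. root_unity t ^ s)"
      unfolding sum_distrib_left by (intro sum.cong refl) (metis c lessThan_iff)
    then show "GBG_rank t xs = of_int k"
      unfolding rank using sum_root_unity[OF t] by simp
  qed
qed

section \<open>Residue classes of an initial segment\<close>

lemma sum_group_mod:
  fixes f :: "nat \<Rightarrow> nat"
  assumes "finite X" and "0 < t"
  shows "(\<Sum>r<t. \<Sum>x | x \<in> X \<and> x mod t = r. f x) = sum f X"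
  using assms by (intro sum.group) auto

lemma card_group_mod:
  fixes X :: "nat set"
  assumes "finite X" and "0 < t"
  shows "(\<Sum>r<t. card {x \<in> X. x mod t = r}) = card X"
  using sum_group_mod[OF assms, of "\<lambda>_. 1"] by simp

lemma residue_class_lessThan:
  fixes t N \<nu> r :: nat
  assumes "\<nu> < t" and "r < t"
  shows "{x \<in> {..<t * N + \<nu>}. x mod t = r} = (\<lambda>y. t * y + r) ` {..<N + of_bool (r < \<nu>)}"
proof -
  have iff: "t * y + r < t * N + \<nu> \<longleftrightarrow> y < N + of_bool (r < \<nu>)" for y
  proof (cases y N rule: linorder_cases)
    case less
    then have "t * Suc y \<le> t * N"
      by (intro mult_le_mono2) simp
    then show ?thesis
      using assms less by (simp add: algebra_simps)
  next
    case greater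
    then have "t * Suc N \<le> t * y"
      by (intro mult_le_mono2) simp
    then show ?thesis
      using assms greater by (simp add: algebra_simps)
  qed simp
  show ?thesis
  proof (intro equalityI subsetI)
    fix x assume x: "x \<in> {x \<in> {..<t * N + \<nu>}. x mod t = r}"
    then have "x = t * (x div t) + r"
      using mult_div_mod_eq[of t x] by simp
    with x iff[of "x div t"] show "x \<in> (\<lambda>y. t * y + r) ` {..<N + of_bool (r < \<nu>)}"
      by (metis (no_types, lifting) image_eqI lessThan_iff mem_Collect_eq)
  next
    fix x assume "x \<in> (\<lambda>y. t * y + r) ` {..<N + of_bool (r < \<nu>)}"
    then obtain y where "x = t * y + r" "y < N + of_bool (r < \<nu>)"
      by blast
    then show "x \<in> {x \<in> {..<t * N + \<nu>}. x mod t = r}"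
      using iff[of y] assms(2) by simp
  qed
qed

lemma card_residue_class_lessThan:
  fixes t N \<nu> r :: nat
  assumes "\<nu> < t" and "r < t"
  shows "card {x \<in> {..<t * N + \<nu>}. x mod t = r} = N + of_bool (r < \<nu>)"
  using assms by (subst residue_class_lessThan) (auto simp: card_image inj_on_def)

text \<open>Regroups the beta-set of the empty partition by residues; this is the exponent for
  \<open>k = 0\<close>.\<close>

lemma sum_residue_classes_lessThan:
  fixes t N \<nu> :: nat
  assumes "\<nu> < t"
  shows "(\<Sum>r<t. r * (N + of_bool (r < \<nu>)) + t * \<Sum> {..<N + of_bool (r < \<nu>)}) = \<Sum> {..<t * N + \<nu>}"
proof -
  have "\<Sum> {..<t * N + \<nu>} = (\<Sum>r<t. \<Sum>x | x \<in> {..<t * N + \<nu>} \<and> x mod t = r. x)"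
    using assms by (intro sum_group_mod[symmetric]) auto
  also have "\<dots> = (\<Sum>r<t. r * (N + of_bool (r < \<nu>)) + t * \<Sum> {..<N + of_bool (r < \<nu>)})"
  proof (intro sum.cong refl)
    fix r assume "r \<in> {..<t}"
    then have "{x. x \<in> {..<t * N + \<nu>} \<and> x mod t = r} = (\<lambda>y. t * y + r) ` {..<N + of_bool (r < \<nu>)}"
      using residue_class_lessThan[OF assms, of r N] by simp
    then show "(\<Sum>x | x \<in> {..<t * N + \<nu>} \<and> x mod t = r. x) =
        r * (N + of_bool (r < \<nu>)) + t * \<Sum> {..<N + of_bool (r < \<nu>)}"
      using assms by (simp add: sum.reindex inj_on_def sum.distrib sum_distrib_left)
  qed
  finally show ?thesis ..
qed

text \<open>
  Labels \<open>s\<close> and \<open>s + 1\<close> are compared by the beta-numbers congruent to \<open>t * N + \<nu> - 1 - s\<close> modulo \<open>t\<close>.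
\<close>

definition label_residue :: "nat \<Rightarrow> nat \<Rightarrow> nat \<Rightarrow> nat" where
  "label_residue t \<nu> s = (if s < \<nu> then \<nu> - 1 - s else \<nu> + t - 1 - s)"

lemma label_residue_less: "\<nu> < t \<Longrightarrow> s < t \<Longrightarrow> label_residue t \<nu> s < t"
  by (auto simp: label_residue_def)

lemma label_residue_involution: "\<nu> < t \<Longrightarrow> s < t \<Longrightarrow> label_residue t \<nu> (label_residue t \<nu> s) = s"
  by (auto simp: label_residue_def)

lemma bij_betw_label_residue: "\<nu> < t \<Longrightarrow> bij_betw (label_residue t \<nu>) {..<t} {..<t}"
  by (rule bij_betw_byWitness[where f' = "label_residue t \<nu>"])
    (auto simp: label_residue_involution label_residue_less)

lemma residue_count_eq_card:
  assumes "finite A" "\<nu> < t" "s < t"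
  shows "residue_count t (int (t * N + \<nu>) - 1 - int s) A = int (card {x \<in> A. x mod t = label_residue t \<nu> s})"
proof -
  have "int t dvd int x - (int (t * N + \<nu>) - 1 - int s) \<longleftrightarrow> x mod t = label_residue t \<nu> s" for x
  proof -
    \<comment> \<open>Reduction into the range below \<open>t\<close> subtracts \<open>N\<close>
      periods, or \<open>N - 1\<close> if \<open>s\<close> has reached \<open>\<nu>\<close>.\<close>
    have "int (label_residue t \<nu> s) = (int (t * N + \<nu>) - 1 - int s) + int t * (of_bool (\<nu> \<le> s) - int N)"
      using assms by (auto simp: label_residue_def of_nat_diff algebra_simps)
    then have "(int (t * N + \<nu>) - 1 - int s) mod int t = int (label_residue t \<nu> s) mod int t"
      by simp
    also have "\<dots> = int (label_residue t \<nu> s)"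
      using label_residue_less[OF assms(2,3)] by simp
    finally show ?thesis
      by (simp flip: mod_eq_dvd_iff zmod_int)
  qed
  then show ?thesis
    using assms(1) by (simp add: residue_count_def Int_def)
qed

text \<open>
  The number of beta-numbers in each residue class forced by the GBG-rank: the count for the empty
  partition, with \<open>k\<close> beads moved from the class of label \<open>0\<close> to that of label \<open>t - 1\<close>.
\<close>

definition residue_profile :: "nat \<Rightarrow> nat \<Rightarrow> nat \<Rightarrow> int \<Rightarrow> nat \<Rightarrow> int" where
  "residue_profile t N \<nu> k r =
    int N + of_bool (r < \<nu>) - k * of_bool (r = label_residue t \<nu> 0) + k * of_bool (r = \<nu>)"

text \<open>As \<open>\<nu>\<close> and \<open>i\<close> are below \<open>t\<close>, the ceiling is
  1 or 0 according to whether \<open>i < \<nu>\<close>. The factor of index \<open>i\<close> thus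
  belongs to the class of label \<open>i\<close>.\<close>

lemma residue_profile_label_residue:
  assumes "2 \<le> t" and "\<nu> < t" and "i < t"
  shows "residue_profile t N \<nu> k (label_residue t \<nu> i) =
    int N + \<lceil>(real \<nu> - real i) / real t\<rceil> - k * of_bool (i = 0) + k * of_bool (i = t - 1)"
proof -
  have "\<lceil>(real \<nu> - real i) / real t\<rceil> = of_bool (i < \<nu>)"
    using assms by (intro ceiling_unique) (auto simp: field_simps)
  moreover have "label_residue t \<nu> i < \<nu> \<longleftrightarrow> i < \<nu>" "label_residue t \<nu> i = label_residue t \<nu> 0 \<longleftrightarrow> i = 0"
    "label_residue t \<nu> i = \<nu> \<longleftrightarrow> i = t - 1"
    using assms by (auto simp: label_residue_def)
  ultimately show ?thesis
    by (simp add: residue_profile_def)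
qed

lemma two_sum_lessThan: "2 * int (\<Sum> {..<n}) = int n * (int n - 1)"
  by (induction n) (auto simp: algebra_simps)

text \<open>Only two classes differ from the empty partition: one loses and one gains
  \<open>k\<close> beads. The change of their quadratic contributions is the exponent in the
  theorem.\<close>

lemma residue_profile_exponent:
  assumes "2 \<le> t" and "\<nu> < t" and nonneg: "\<And>r. r < t \<Longrightarrow> 0 \<le> residue_profile t N \<nu> k r"
  defines "m \<equiv> \<lambda>r. nat (residue_profile t N \<nu> k r)"
  shows "(\<Sum>r<t. r * m r + t * \<Sum> {..<m r}) =
    \<Sum> {..<t * N + \<nu>} + nat (int t * k\<^sup>2 - (int t - 1) * k)"
proof -
  define n where "n r = N + of_bool (r < \<nu>)" for r
  \<comment> \<open>Twice the contribution of \<open>j\<close> beads in the class of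
    \<open>r\<close>, to avoid halving; \<open>j\<close> is an integer so that \<open>k\<close> can
    be added or subtracted.\<close>
  define e where "e r j = 2 * int r * j + int t * (j * (j - 1))" for r j
  have e: "2 * int (\<Sum>r<t. r * j r + t * \<Sum> {..<j r}) = (\<Sum>r<t. e r (int (j r)))" for j
  proof -
    have "2 * int (r * j r + t * \<Sum> {..<j r}) = 2 * int r * int (j r) + int t * (2 * int (\<Sum> {..<j r}))" for r
      by (simp del: of_nat_sum add: algebra_simps)
    then have "2 * int (r * j r + t * \<Sum> {..<j r}) = e r (int (j r))" for r
      by (simp only: two_sum_lessThan e_def)
    then show ?thesis
      by (simp only: of_nat_sum[where A = "{..<t}"] sum_distrib_left[where A = "{..<t}"])
  qed
  let ?r = "label_residue t \<nu> 0"
  have m: "int (m r) = int (n r) - k * of_bool (r = ?r) + k * of_bool (r = \<nu>)" if "r < t" for r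
    using nonneg[OF that] by (simp add: m_def n_def residue_profile_def)
  have ne: "?r \<noteq> \<nu>" "?r < t"
    using assms by (auto simp: label_residue_def)
  have "(\<Sum>r<t. e r (int (m r))) - (\<Sum>r<t. e r (int (n r))) =
      (\<Sum>r<t. e r (int (m r)) - e r (int (n r)))"
    by (simp add: sum_subtractf)
  also have "\<dots> = (\<Sum>r\<in>{?r, \<nu>}. e r (int (m r)) - e r (int (n r)))"
    using assms(2) ne m by (intro sum.mono_neutral_right) auto
  also have "\<dots> = (e ?r (int (n ?r) - k) - e ?r (int (n ?r))) + (e \<nu> (int (n \<nu>) + k) - e \<nu> (int (n \<nu>)))"
    using ne assms(2) by (simp add: m)
  \<comment> \<open>For \<open>\<nu> = 0\<close> the class of label 0 wraps around to
    \<open>t - 1\<close>; otherwise it is \<open>\<nu> - 1\<close> and starts with one bead more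
    than the class of \<open>\<nu>\<close>.\<close>
  also have "\<dots> = 2 * (int t * k\<^sup>2 - (int t - 1) * k)"
    using assms(1,2) by (cases "\<nu> = 0")
      (simp_all add: e_def n_def label_residue_def of_nat_diff power2_eq_square algebra_simps)
  finally have "2 * int (\<Sum>r<t. r * m r + t * \<Sum> {..<m r}) =
      2 * int (\<Sum>r<t. r * n r + t * \<Sum> {..<n r}) + 2 * (int t * k\<^sup>2 - (int t - 1) * k)"
    unfolding e by simp
  also have "(\<Sum>r<t. r * n r + t * \<Sum> {..<n r}) = \<Sum> {..<t * N + \<nu>}"
    unfolding n_def by (rule sum_residue_classes_lessThan) fact
  also have "int t * k\<^sup>2 - (int t - 1) * k = int (nat (int t * k\<^sup>2 - (int t - 1) * k))"
    using exponent_nonneg[of t k] assms(1) by simp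
  finally show ?thesis
    by linarith
qed

text \<open>The gain and the loss of \<open>k\<close> cancel. Hence the prescribed counts force the
  right cardinality of a beta-set.\<close>

lemma sum_residue_profile:
  assumes "2 \<le> t" and "\<nu> < t"
  shows "(\<Sum>r<t. residue_profile t N \<nu> k r) = int (t * N + \<nu>)"
proof -
  have "label_residue t \<nu> 0 < t"
    using assms by (simp add: label_residue_less)
  moreover have "(\<Sum>r<t. of_bool (r < \<nu>) :: int) = int \<nu>"
  proof -
    have "{..<t} \<inter> {r. r < \<nu>} = {..<\<nu>}"
      using assms by auto
    then show ?thesis by simp
  qed
  moreover have "(\<Sum>r<t. of_bool (r = a) :: int) = 1" if "a < t" for a
    using that by simp
  ultimately show ?thesis
    using assms by (simp add: residue_profile_def sum.distrib sum_subtractf del: sum_of_bool_eq flip: sum_distrib_left)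
qed

text \<open>The differences of label counts compare the beta-set with
  \<open>{..<t * N + \<nu>}\<close> class by class, and \<open>label_residue\<close> permutes the
  residues.\<close>

lemma GBG_rank_eq_iff_profile:
  assumes "prime t" and "\<nu> < t" and "xs \<in> bounded_partitions (t * N + \<nu>)"
  shows "GBG_rank t xs = of_int k \<longleftrightarrow>
    (\<forall>r<t. int (card {x \<in> beta_set (t * N + \<nu>) xs. x mod t = r}) = residue_profile t N \<nu> k r)"
proof -
  let ?M = "t * N + \<nu>" and ?\<rho> = "label_residue t \<nu>"
  have t: "2 \<le> t"
    using assms(1) by (rule prime_ge_2_nat)
  have "int (label_count t (int s) xs) - int (label_count t (int s + 1) xs) =
      k * of_bool (s = 0) - k * of_bool (s = t - 1) \<longleftrightarrow>
      int (card {x \<in> beta_set ?M xs. x mod t = ?\<rho> s}) = residue_profile t N \<nu> k (?\<rho> s)" if "s < t" for s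
  proof -
    have "?\<rho> s = ?\<rho> 0 \<longleftrightarrow> s = 0" "?\<rho> s = \<nu> \<longleftrightarrow> s = t - 1"
      using t assms(2) that by (auto simp: label_residue_def)
    then show ?thesis
      unfolding label_count_diff[OF assms(3)] residue_profile_def
      using residue_count_eq_card[of "beta_set ?M xs" \<nu> t s N] residue_count_eq_card[of "{..<?M}" \<nu> t s N]
        card_residue_class_lessThan[of \<nu> t "?\<rho> s" N] label_residue_less[of \<nu> t s] assms(2) that
      by auto
  qed
  then have "GBG_rank t xs = of_int k \<longleftrightarrow>
      (\<forall>s\<in>{..<t}. int (card {x \<in> beta_set ?M xs. x mod t = ?\<rho> s}) = residue_profile t N \<nu> k (?\<rho> s))"
    unfolding GBG_rank_eq_iff[OF assms(1)] by auto
  also have "\<dots> \<longleftrightarrow> (\<forall>r\<in>?\<rho> ` {..<t}. int (card {x \<in> beta_set ?M xs. x mod t = r}) = residue_profile t N \<nu> k r)"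
    by simp
  also have "?\<rho> ` {..<t} = {..<t}"
    using bij_betw_label_residue[OF assms(2)] by (simp add: bij_betw_def)
  finally show ?thesis
    by (simp add: Ball_def)
qed

theorem theorem1p1:
  fixes t N \<nu> :: nat and k :: int
  assumes "prime t" and "\<nu> \<in> {0..t - 1}"
  shows "G (t * N + \<nu>) t k =
    fps_X ^ nat (int t * k\<^sup>2 - (int t - 1) * k) *
    (\<Prod>i = 0..t - 1. recip_qpoch (fps_X ^ t)
      (int N + \<lceil>(real \<nu> - real i) / real t\<rceil>
        - k * of_bool (i = 0) + k * of_bool (i = t - 1)))"
proof -
  have t: "2 \<le> t"
    using assms(1) by (rule prime_ge_2_nat)
  then have \<nu>: "\<nu> < t"
    using assms(2) by auto
  let ?M = "t * N + \<nu>" and ?e = "nat (int t * k\<^sup>2 - (int t - 1) * k)"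
  let ?p = "residue_profile t N \<nu> k"
  define P where "P = {xs \<in> bounded_partitions ?M. GBG_rank t xs = of_int k}"
  define Q where "Q = {X \<in> card_sets ?M. \<forall>r<t. int (card {x \<in> X. x mod t = r}) = ?p r}"
  have G: "G ?M t k = weight_gf P sum_list"
    unfolding G_def part_gf_def weight_gf_def P_def bounded_partitions_def
    by (simp add: conj_commute conj_left_commute)
  have "bij_betw (beta_set ?M) P Q"
  proof -
    have P: "P = {xs \<in> bounded_partitions ?M. \<forall>r<t. int (card {x \<in> beta_set ?M xs. x mod t = r}) = ?p r}"
      unfolding P_def using GBG_rank_eq_iff_profile[OF assms(1) \<nu>, of _ N k] by blast
    have card_sets: "card_sets ?M = beta_set ?M ` bounded_partitions ?M"
      using bij_betw_beta_set[of ?M] by (simp add: bij_betw_def)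
    have "Q = beta_set ?M ` P"
      unfolding P Q_def card_sets by blast
    moreover have "inj_on (beta_set ?M) P"
      using bij_betw_beta_set[of ?M] unfolding bij_betw_def P_def
      by (auto intro: inj_on_subset)
    ultimately show ?thesis
      by (simp add: bij_betw_def)
  qed
  then have "weight_gf P (\<lambda>xs. sum_list xs + \<Sum> {..<?M}) = weight_gf Q Sum"
    by (rule weight_gf_bij) (auto simp: P_def sum_beta_set)
  \<comment> \<open>The triangular number stays on the left as a factor, which is cancelled at the
    end.\<close>
  then have shifted: "fps_X ^ \<Sum> {..<?M} * G ?M t k = weight_gf Q Sum"
    by (simp add: G weight_gf_add)
  have "(\<Prod>i = 0..t - 1. recip_qpoch (fps_X ^ t)
        (int N + \<lceil>(real \<nu> - real i) / real t\<rceil> - k * of_bool (i = 0) + k * of_bool (i = t - 1))) =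
      (\<Prod>i<t. recip_qpoch (fps_X ^ t) (?p (label_residue t \<nu> i)))"
    using t \<nu> by (intro prod.cong) (auto simp: residue_profile_label_residue)
  also have "\<dots> = (\<Prod>r<t. recip_qpoch (fps_X ^ t) (?p r))"
    using bij_betw_label_residue[OF \<nu>] by (rule prod.reindex_bij_betw)
  finally have prod: "(\<Prod>i = 0..t - 1. recip_qpoch (fps_X ^ t)
        (int N + \<lceil>(real \<nu> - real i) / real t\<rceil> - k * of_bool (i = 0) + k * of_bool (i = t - 1))) =
      (\<Prod>r<t. recip_qpoch (fps_X ^ t) (?p r))" .
  have "weight_gf Q Sum = fps_X ^ (\<Sum> {..<?M} + ?e) * (\<Prod>r<t. recip_qpoch (fps_X ^ t) (?p r))"
  proof (cases "\<forall>r<t. 0 \<le> ?p r")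
    case True
    let ?m = "\<lambda>r. nat (?p r)"
    have "Q = residue_sets t {..<t} ?m"
    proof (intro equalityI subsetI)
      fix X assume X: "X \<in> residue_sets t {..<t} ?m"
      then have fin: "finite X" and c: "\<And>r. r < t \<Longrightarrow> int (card {x \<in> X. x mod t = r}) = ?p r"
        using True by (auto simp: residue_sets_def)
      have "card X = (\<Sum>r<t. card {x \<in> X. x mod t = r})"
        using t by (intro card_group_mod[symmetric] fin) simp
      then have "int (card X) = (\<Sum>r<t. int (card {x \<in> X. x mod t = r}))"
        by simp
      also have "\<dots> = int ?M"
        using c sum_residue_profile[OF t \<nu>, of N k] by simp
      finally have "card X = ?M"
        by (simp only: of_nat_eq_iff)
      then show "X \<in> Q"
        using fin c by (simp add: Q_def card_sets_def)
    next
      fix X assume X: "X \<in> Q"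
      then have "card {x \<in> X. x mod t = r} = ?m r" if "r < t" for r
        using that by (auto simp: Q_def dest: spec[of _ r])
      with X t show "X \<in> residue_sets t {..<t} ?m"
        by (auto simp: Q_def card_sets_def residue_sets_def)
    qed
    then have "weight_gf Q Sum =
        fps_X ^ (\<Sum>r<t. r * ?m r + t * \<Sum> {..<?m r}) * (\<Prod>r<t. recip_qpoch (fps_X ^ t) (int (?m r)))"
      by (simp add: weight_gf_residue_sets)
    also have "(\<Prod>r<t. recip_qpoch (fps_X ^ t) (int (?m r))) = (\<Prod>r<t. recip_qpoch (fps_X ^ t) (?p r))"
      using True by (intro prod.cong) auto
    also have "(\<Sum>r<t. r * ?m r + t * \<Sum> {..<?m r}) = \<Sum> {..<?M} + ?e"
      using True by (intro residue_profile_exponent[OF t \<nu>]) auto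
    finally show ?thesis .
  \<comment> \<open>A negative prescribed count admits no set at all, and the convention for
    negative subscripts makes the product vanish.\<close>
  next
    case False
    then obtain r where r: "r < t" "?p r < 0"
      by (auto simp: not_le)
    have "X \<notin> Q" for X
    proof
      assume "X \<in> Q"
      then have "int (card {x \<in> X. x mod t = r}) = ?p r"
        using r(1) by (simp add: Q_def)
      with r(2) show False by simp
    qed
    then have "Q = {}" by blast
    moreover have "(\<Prod>r<t. recip_qpoch (fps_X ^ t) (?p r)) = 0"
      using r by (intro prod_zero) (auto simp: recip_qpoch_def)
    ultimately show ?thesis by simp
  qed
  then have "fps_X ^ \<Sum> {..<?M} * G ?M t k =
      fps_X ^ \<Sum> {..<?M} * (fps_X ^ ?e * (\<Prod>r<t. recip_qpoch (fps_X ^ t) (?p r)))"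
    by (simp only: shifted power_add mult.assoc)
  then show ?thesis
    unfolding prod by simp
qed

end
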